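(* Let $(z^j)_{j\ge0}$ be generated by the relaxed Peaceman-Rachford iteration with relaxation parameters $(\lambda_j)_{j\ge0}\subset(0,1]$, let $z^\ast$ be a fixed point of $T_{\mathrm{PRS}}$, and let $x^\ast=\mathbf{prox}_{\gamma g}(z^\ast)$. Suppose that $f$ is $\mu_f$-strongly convex and differentiable with $(1/\beta_f)$-Lipschitz gradient, where $\mu_f\beta_f>0$. For $\lambda\in[0,1]$ let $$C(\lambda):=\Big(1-\frac\lambda2\min\Big\{\frac{4\gamma\mu_f}{(1+\gamma/\beta_f)^2},\,1-\lambda\Big\}\Big)^{1/2}.$$ Then for all $k\ge0$, $\|z^{k+1}-z^\ast\|\le C(\lambda_k)\|z^k-z^\ast\|$.
   Context: $\mathcal H$ is a real Hilbert space; $f,g:\mathcal H\to(-\infty,\infty]$ are closed, proper, convex, and there is $x\in\mathcal H$ with $0\in\partial f(x)+\partial g(x)$. Fix $\gamma>0$. $\mathbf{prox}_{\gamma f}(x)=\arg\min_y f(y)+\frac1{2\gamma}\|y-x\|^2$, $\mathbf{refl}_{\gamma f}=2\,\mathbf{prox}_{\gamma f}-I$, $T_{\mathrm{PRS}}=\mathbf{refl}_{\gamma f}\circ\mathbf{refl}_{\gamma g}$. Differentiable means Fréchet differentiable on $\mathcal H$. Relaxed Peaceman-Rachford iteration: $z^0\in\mathcal H$ arbitrary, $z^{k+1}=(1-\lambda_k)z^k+\lambda_kT_{\mathrm{PRS}}z^k$. *)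

theory Defs
  imports "HOL-Analysis.Analysis"
begin

text \<open>
  The Hilbert space is a type of sort \<open>{real_inner, complete_space}\<close>.  Functions with
  values in \<open>(-\<infinity>, \<infinity>]\<close> are \<open>ereal\<close>-valued; the value \<open>-\<infinity>\<close> is excluded by properness.
\<close>

definition proper_fun :: "('a \<Rightarrow> ereal) \<Rightarrow> bool" where
  "proper_fun f \<longleftrightarrow> (\<forall>x. f x \<noteq> -\<infinity>) \<and> (\<exists>x. f x \<noteq> \<infinity>)"

text \<open>Closedness is closedness of the epigraph, a subset of \<open>'a \<times> real\<close>.\<close>

definition closed_fun :: "('a::topological_space \<Rightarrow> ereal) \<Rightarrow> bool" where
  "closed_fun f \<longleftrightarrow> closed {(x, r :: real). f x \<le> ereal r}"

text \<open>
  Both convexity inequalities are meant for functions that avoid \<open>-\<infinity>\<close>.  In \<open>ereal\<close>,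
  \<open>0 * \<infinity> = 0\<close>, so the end points \<open>t = 0\<close> and \<open>t = 1\<close> impose no condition.
\<close>

definition convex_fun :: "('a::real_vector \<Rightarrow> ereal) \<Rightarrow> bool" where
  "convex_fun f \<longleftrightarrow>
    (\<forall>x y t. 0 \<le> t \<and> t \<le> 1 \<longrightarrow>
      f (t *\<^sub>R x + (1 - t) *\<^sub>R y) \<le> ereal t * f x + ereal (1 - t) * f y)"

definition strongly_convex_fun :: "real \<Rightarrow> ('a::real_normed_vector \<Rightarrow> ereal) \<Rightarrow> bool" where
  "strongly_convex_fun \<mu> f \<longleftrightarrow>
    (\<forall>x y t. 0 \<le> t \<and> t \<le> 1 \<longrightarrow>
      f (t *\<^sub>R x + (1 - t) *\<^sub>R y) + ereal (\<mu> / 2 * t * (1 - t) * (norm (x - y))\<^sup>2)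
        \<le> ereal t * f x + ereal (1 - t) * f y)"

definition subdiff :: "('a::real_inner \<Rightarrow> ereal) \<Rightarrow> 'a \<Rightarrow> 'a set" where
  "subdiff f x = {u. \<forall>y. f x + ereal (u \<bullet> (y - x)) \<le> f y}"

text \<open>Differentiability on the whole space forces the function to be finite everywhere.\<close>

definition differentiable_with_lipschitz_gradient ::
    "real \<Rightarrow> ('a::real_inner \<Rightarrow> ereal) \<Rightarrow> bool" where
  "differentiable_with_lipschitz_gradient L f \<longleftrightarrow>
    (\<forall>x. \<bar>f x\<bar> \<noteq> \<infinity>) \<and>
    (\<exists>G. (\<forall>x. GDERIV (\<lambda>y. real_of_ereal (f y)) x :> G x) \<and> L-lipschitz_on UNIV G)"

text \<open>
  For closed, proper, convex \<open>f\<close> and \<open>\<gamma> > 0\<close> the minimizer exists and is unique, so the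
  choice made by \<open>arg_min\<close> is immaterial.
\<close>

definition prox :: "real \<Rightarrow> ('a::real_inner \<Rightarrow> ereal) \<Rightarrow> 'a \<Rightarrow> 'a" where
  "prox \<gamma> f x = (ARG_MIN (\<lambda>y. f y + ereal (1 / (2 * \<gamma>) * (norm (y - x))\<^sup>2)) y. True)"

definition refl_prox :: "real \<Rightarrow> ('a::real_inner \<Rightarrow> ereal) \<Rightarrow> 'a \<Rightarrow> 'a" where
  "refl_prox \<gamma> f x = 2 *\<^sub>R prox \<gamma> f x - x"

definition T_PRS ::
    "real \<Rightarrow> ('a::real_inner \<Rightarrow> ereal) \<Rightarrow> ('a \<Rightarrow> ereal) \<Rightarrow> 'a \<Rightarrow> 'a" where
  "T_PRS \<gamma> f g = refl_prox \<gamma> f \<circ> refl_prox \<gamma> g"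

definition relaxed_PRS ::
    "real \<Rightarrow> ('a::real_inner \<Rightarrow> ereal) \<Rightarrow> ('a \<Rightarrow> ereal) \<Rightarrow> (nat \<Rightarrow> real) \<Rightarrow> (nat \<Rightarrow> 'a) \<Rightarrow> bool" where
  "relaxed_PRS \<gamma> f g lam z \<longleftrightarrow>
    (\<forall>k. z (Suc k) = (1 - lam k) *\<^sub>R z k + lam k *\<^sub>R T_PRS \<gamma> f g (z k))"

definition PRS_factor :: "real \<Rightarrow> real \<Rightarrow> real \<Rightarrow> real \<Rightarrow> real" where
  "PRS_factor \<gamma> \<mu> \<beta> l = sqrt (1 - l / 2 * min (4 * \<gamma> * \<mu> / (1 + \<gamma> / \<beta>)\<^sup>2) (1 - l))"

end

theory Submission
  imports Defs
begin

text \<open>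
  A proximal step \<open>p = prox x\<close> satisfies \<open>(x - p) / \<gamma> \<in> \<partial>f p\<close>.  For two such steps put
  \<open>d = p - p'\<close> and \<open>e = (x - p) - (x' - p')\<close>.  The reflection maps the difference \<open>d + e\<close>
  to \<open>d - e\<close>, and \<open>\<parallel>d - e\<parallel>\<^sup>2 = \<parallel>d + e\<parallel>\<^sup>2 - 4 (d \<bullet> e)\<close>.  Monotonicity gives \<open>d \<bullet> e \<ge> 0\<close>, so
  reflections are nonexpansive; strong convexity gives \<open>d \<bullet> e \<ge> \<gamma> \<mu> \<parallel>d\<parallel>\<^sup>2\<close> and the Lipschitz
  gradient gives \<open>\<parallel>d + e\<parallel> \<le> (1 + \<gamma> / \<beta>) \<parallel>d\<parallel>\<close>, so the reflection of \<open>f\<close> contracts squared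
  distances by \<open>1 - 4 \<gamma> \<mu> / (1 + \<gamma> / \<beta>)\<^sup>2\<close>.  Convexity of \<open>\<parallel>\<cdot>\<parallel>\<^sup>2\<close> passes this to the
  relaxed step.
\<close>

section \<open>Limits along segments and finite values\<close>

lemma le_if_le_add_small_mult:
  fixes a b c :: real
  assumes "\<And>t. 0 < t \<Longrightarrow> t < 1 \<Longrightarrow> a \<le> b + t * c"
  shows "a \<le> b"
proof (rule tendsto_lowerbound)
  show "((\<lambda>t. b + t * c) \<longlongrightarrow> b) (at_right 0)"
    by (auto intro!: tendsto_eq_intros)
  show "\<forall>\<^sub>F t in at_right 0. a \<le> b + t * c"
    using eventually_at_right_real[OF zero_less_one] by (rule eventually_mono) (auto intro: assms)
qed simp

text \<open>At a point of value infinity the subgradient inequality would force the value infinity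
  everywhere, against properness.\<close>

lemma subdiff_finite:
  assumes "proper_fun f" and "u \<in> subdiff f a"
  obtains r where "f a = ereal r"
proof -
  obtain y where y: "f y \<noteq> \<infinity>"
    using assms(1) by (auto simp: proper_fun_def)
  have "f a + ereal (u \<bullet> (y - a)) \<le> f y"
    using assms(2) by (auto simp: subdiff_def)
  then have "f a \<noteq> \<infinity>" using y by auto
  moreover have "f a \<noteq> -\<infinity>" using assms(1) by (auto simp: proper_fun_def)
  ultimately show thesis using that by (cases "f a") auto
qed

lemma convex_funD:
  assumes "convex_fun f" and "f x = ereal a" and "f y = ereal b" and "0 \<le> t" and "t \<le> 1"
  shows "f (t *\<^sub>R x + (1 - t) *\<^sub>R y) \<le> ereal (t * a + (1 - t) * b)"
  using assms unfolding convex_fun_def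
  by (metis plus_ereal.simps(1) times_ereal.simps(1))

section \<open>The proximal point: existence and optimality condition\<close>

lemma norm_sq_midpoint:
  fixes u v :: "'a::real_inner"
  shows "(norm ((1/2) *\<^sub>R u + (1 - 1/2) *\<^sub>R v))\<^sup>2
    = (norm u)\<^sup>2 / 2 + (norm v)\<^sup>2 / 2 - (norm (u - v))\<^sup>2 / 4"
  unfolding power2_norm_eq_inner
  by (simp add: inner_add_left inner_add_right inner_diff_left inner_diff_right
      inner_commute field_simps)

lemma norm_sq_scaleR_diff:
  fixes d e :: "'a::real_inner"
  shows "(norm (t *\<^sub>R d - e))\<^sup>2 = t\<^sup>2 * (norm d)\<^sup>2 - 2 * t * (e \<bullet> d) + (norm e)\<^sup>2"
  unfolding power2_norm_eq_inner
  by (simp add: inner_diff_left inner_diff_right inner_commute power2_eq_square)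

lemma subdiff_prox_bounded_below:
  assumes "\<gamma> > 0" and "u \<in> subdiff f a" and "f a = ereal r" and "f y = ereal b"
  shows "r + u \<bullet> (x - a) - \<gamma> / 2 * (norm u)\<^sup>2 \<le> b + 1 / (2 * \<gamma>) * (norm (y - x))\<^sup>2"
proof -
  have "ereal r + ereal (u \<bullet> (y - a)) \<le> ereal b"
    using assms(2-4) unfolding subdiff_def by (metis (mono_tags, lifting) mem_Collect_eq)
  then have b: "r + u \<bullet> (y - a) \<le> b" by simp
  \<comment> \<open>Completing the square: divided by \<open>2 * \<gamma>\<close>, this expansion
    bounds the linear term of the affine minorant by the quadratic penalty.\<close>
  have "0 \<le> (norm (\<gamma> *\<^sub>R u + (y - x)))\<^sup>2" by simp
  also have "\<dots> = \<gamma>\<^sup>2 * (norm u)\<^sup>2 + 2 * \<gamma> * (u \<bullet> (y - x)) + (norm (y - x))\<^sup>2"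
    unfolding power2_norm_eq_inner
    by (simp add: inner_add_left inner_add_right inner_commute power2_eq_square algebra_simps)
  finally have "0 \<le> \<gamma> / 2 * (norm u)\<^sup>2 + u \<bullet> (y - x) + 1 / (2 * \<gamma>) * (norm (y - x))\<^sup>2"
    using assms(1) by (simp add: field_simps power2_eq_square)
  with b show ?thesis by (simp add: inner_diff_right)
qed

text \<open>The quadratic penalty makes the objective uniformly convex, so a minimizing sequence is
  Cauchy; completeness gives a limit, and the closed epigraph makes it a minimizer. The subgradient
  supplies a finite value and a lower bound for the objective.\<close>

lemma prox_minimizer_exists:
  fixes f :: "'a::{real_inner, complete_space} \<Rightarrow> ereal"
  assumes "closed_fun f" and "proper_fun f" and "convex_fun f" and "\<gamma> > 0"
    and "u \<in> subdiff f a"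
  shows "\<exists>p. \<forall>y. f p + ereal (1 / (2 * \<gamma>) * (norm (p - x))\<^sup>2)
    \<le> f y + ereal (1 / (2 * \<gamma>) * (norm (y - x))\<^sup>2)"
proof -
  define q where "q y = 1 / (2 * \<gamma>) * (norm (y - x))\<^sup>2" for y
  \<comment> \<open>Only finite values are collected, so the infimum can be taken in the
    reals.\<close>
  define V where "V = {b + q y | b y. f y = ereal b}"
  define m where "m = Inf V"
  obtain r where r: "f a = ereal r" using subdiff_finite[OF assms(2,5)] .
  have bdd: "bdd_below V"
    using subdiff_prox_bounded_below[OF assms(4,5) r, of _ _ x]
    unfolding bdd_below_def V_def q_def by blast
  have ne: "V \<noteq> {}" using r unfolding V_def by blast
  have m_le: "m \<le> b + q y" if "f y = ereal b" for b y
    unfolding m_def by (rule cInf_lower[OF _ bdd]) (use that V_def in blast)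
  have near: "\<exists>y b. f y = ereal b \<and> b + q y < m + e" if "e > 0" for e
  proof -
    have "Inf V < m + e" using that by (simp add: m_def)
    then obtain v where "v \<in> V" "v < m + e" using cInf_lessD[OF ne] by blast
    then show ?thesis unfolding V_def by blast
  qed
  have "\<forall>n. \<exists>y b. f y = ereal b \<and> b + q y < m + inverse (real (Suc n))"
    using near by simp
  then obtain Y B where Y: "\<And>n. f (Y n) = ereal (B n)"
    and BY: "\<And>n. B n + q (Y n) < m + inverse (real (Suc n))"
    by metis
  \<comment> \<open>The midpoint of two \<open>e\<close>-approximate minimizers still has objective
    at least \<open>m\<close>, while the parallelogram identity lowers the average by
    \<open>(norm (v - w))^2 / (8 * \<gamma>)\<close>; this gap is therefore at most
    \<open>e\<close>.\<close>
  have close: "(norm (v - w))\<^sup>2 \<le> 8 * \<gamma> * e"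
    if v: "f v = ereal b" "b + q v \<le> m + e" and w: "f w = ereal c" "c + q w \<le> m + e"
    for v w b c e
  proof -
    let ?s = "(1/2) *\<^sub>R v + (1 - 1/2) *\<^sub>R w"
    have le: "f ?s \<le> ereal (1/2 * b + (1 - 1/2) * c)"
      by (rule convex_funD[OF assms(3) v(1) w(1)]) auto
    moreover have "f ?s \<noteq> -\<infinity>" using assms(2) by (auto simp: proper_fun_def)
    ultimately obtain s where s: "f ?s = ereal s" by (cases "f ?s") auto
    \<comment> \<open>Stated for general \<open>t\<close> so that the instance at \<open>1/2\<close>
      keeps the term \<open>1 - 1/2\<close> that \<open>norm_sq_midpoint\<close> matches.\<close>
    have "t *\<^sub>R v + (1 - t) *\<^sub>R w - x = t *\<^sub>R (v - x) + (1 - t) *\<^sub>R (w - x)" for t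
      by (simp add: algebra_simps)
    note mid = this[of "1/2"]
    have "q ?s = q v / 2 + q w / 2 - (norm (v - w))\<^sup>2 / (8 * \<gamma>)"
      unfolding q_def mid norm_sq_midpoint using assms(4) by (simp add: field_simps)
    moreover have "s \<le> b / 2 + c / 2" using le unfolding s by simp
    ultimately have "(norm (v - w))\<^sup>2 / (8 * \<gamma>) \<le> e"
      using m_le[OF s] v(2) w(2) by linarith
    then show ?thesis using assms(4) by (simp add: field_simps)
  qed
  have "Cauchy Y"
  proof (rule metric_CauchyI)
    fix e :: real assume e: "e > 0"
    then have "e\<^sup>2 / (8 * \<gamma>) > 0" using assms(4) by simp
    then obtain N where N: "inverse (real (Suc N)) < e\<^sup>2 / (8 * \<gamma>)"
      using reals_Archimedean by blast
    have small: "B n + q (Y n) \<le> m + inverse (real (Suc N))" if "n \<ge> N" for n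
    proof -
      have "inverse (real (Suc n)) \<le> inverse (real (Suc N))" using that by simp
      then show ?thesis using BY[of n] by linarith
    qed
    have "dist (Y i) (Y j) < e" if "i \<ge> N" "j \<ge> N" for i j
    proof -
      have "(norm (Y i - Y j))\<^sup>2 \<le> 8 * \<gamma> * inverse (real (Suc N))"
        by (rule close[OF Y small Y small]) (use that in auto)
      also have "\<dots> < e\<^sup>2" using N assms(4) by (simp add: field_simps)
      finally show ?thesis using e by (simp add: dist_norm power_less_imp_less_base)
    qed
    then show "\<exists>N. \<forall>i\<ge>N. \<forall>j\<ge>N. dist (Y i) (Y j) < e" by blast
  qed
  then obtain p where p: "Y \<longlonglongrightarrow> p" using Cauchy_convergent convergent_def by blast
  \<comment> \<open>These pairs lie in the epigraph because \<open>Y\<close> is minimizing; their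
    limit gives the value bound at \<open>p\<close>.\<close>
  have "(\<lambda>n. (Y n, m + inverse (real (Suc n)) - q (Y n))) \<longlonglongrightarrow> (p, m + 0 - q p)"
    unfolding q_def by (intro tendsto_intros p LIMSEQ_inverse_real_of_nat)
  moreover have "(Y n, m + inverse (real (Suc n)) - q (Y n)) \<in> {(x, r). f x \<le> ereal r}" for n
    using Y[of n] BY[of n] by simp
  ultimately have "(p, m + 0 - q p) \<in> {(x, r). f x \<le> ereal r}"
    using assms(1) unfolding closed_fun_def by (meson closed_sequentially)
  then have fp: "f p \<le> ereal (m - q p)" by simp
  have "f p + ereal (q p) \<le> f y + ereal (q y)" for y
  proof (cases "f y")
    case (real b)
    have "f p + ereal (q p) \<le> ereal (m - q p) + ereal (q p)" using fp by (rule add_right_mono)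
    also have "\<dots> \<le> f y + ereal (q y)" using m_le[OF real] real by simp
    finally show ?thesis .
  next
    case MInf
    then show ?thesis using assms(2) by (auto simp: proper_fun_def)
  qed auto
  then show ?thesis unfolding q_def by blast
qed

text \<open>Existence of a minimizer is what turns the choice made by \<open>ARG_MIN\<close> into a
  genuine one.\<close>

lemma prox_minimizes:
  fixes f :: "'a::{real_inner, complete_space} \<Rightarrow> ereal"
  assumes "closed_fun f" and "proper_fun f" and "convex_fun f" and "\<gamma> > 0"
    and "u \<in> subdiff f a"
  shows "f (prox \<gamma> f x) + ereal (1 / (2 * \<gamma>) * (norm (prox \<gamma> f x - x))\<^sup>2)
    \<le> f y + ereal (1 / (2 * \<gamma>) * (norm (y - x))\<^sup>2)"
proof -
  let ?h = "\<lambda>y. f y + ereal (1 / (2 * \<gamma>) * (norm (y - x))\<^sup>2)"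
  have "\<exists>p. is_arg_min ?h (\<lambda>_. True) p"
    using prox_minimizer_exists[OF assms, of x] by (simp add: is_arg_min_linorder)
  then have "is_arg_min ?h (\<lambda>_. True) (prox \<gamma> f x)"
    unfolding prox_def arg_min_def by (rule someI_ex)
  then show ?thesis by (simp add: is_arg_min_linorder)
qed

text \<open>The minimizer is compared with points of the segment towards \<open>y\<close>. Convexity
  bounds the change of \<open>f\<close> linearly in \<open>t\<close>, and the penalty is linear up
  to a term in \<open>t^2\<close>; dividing by \<open>t\<close> and letting it tend to 0 leaves the
  subgradient inequality.\<close>

lemma prox_subdiff:
  fixes f :: "'a::{real_inner, complete_space} \<Rightarrow> ereal"
  assumes "closed_fun f" and "proper_fun f" and "convex_fun f" and "\<gamma> > 0"
    and "u \<in> subdiff f a"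
  shows "(1 / \<gamma>) *\<^sub>R (x - prox \<gamma> f x) \<in> subdiff f (prox \<gamma> f x)"
proof -
  define p where "p = prox \<gamma> f x"
  define q where "q y = 1 / (2 * \<gamma>) * (norm (y - x))\<^sup>2" for y
  have min: "f p + ereal (q p) \<le> f y + ereal (q y)" for y
    using prox_minimizes[OF assms] unfolding p_def q_def by blast
  obtain r where r: "f a = ereal r" using subdiff_finite[OF assms(2,5)] .
  have "f p \<noteq> \<infinity>" using min[of a] r by auto
  moreover have "f p \<noteq> -\<infinity>" using assms(2) by (auto simp: proper_fun_def)
  ultimately obtain s where s: "f p = ereal s" by (cases "f p") auto
  have "f p + ereal (((1 / \<gamma>) *\<^sub>R (x - p)) \<bullet> (y - p)) \<le> f y" for y
  proof (cases "f y")
    case (real b)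
    define i where "i = (x - p) \<bullet> (y - p)"
    have "s + i / \<gamma> \<le> b + t * ((norm (y - p))\<^sup>2 / (2 * \<gamma>))" if t: "0 < t" "t < 1" for t
    proof -
      let ?y = "t *\<^sub>R y + (1 - t) *\<^sub>R p"
      have "ereal (s + q p) \<le> f ?y + ereal (q ?y)" using min[of ?y] s by simp
      also have "\<dots> \<le> ereal (t * b + (1 - t) * s) + ereal (q ?y)"
        by (intro add_right_mono convex_funD[OF assms(3) real s]) (use t in auto)
      finally have 1: "s + q p \<le> t * b + (1 - t) * s + q ?y" by simp
      have y: "?y - x = t *\<^sub>R (y - p) - (x - p)" by (simp add: algebra_simps)
      have "q ?y = q p - t * (i / \<gamma>) + t * (t * ((norm (y - p))\<^sup>2 / (2 * \<gamma>)))"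
        using assms(4) unfolding q_def i_def y norm_minus_commute[of p x] norm_sq_scaleR_diff
        by (simp add: field_simps power2_eq_square)
      with 1 have "t * (s + i / \<gamma>) \<le> t * (b + t * ((norm (y - p))\<^sup>2 / (2 * \<gamma>)))"
        by (simp add: algebra_simps)
      then show ?thesis using t by simp
    qed
    then have "s + i / \<gamma> \<le> b" by (rule le_if_le_add_small_mult)
    then show ?thesis using s real by (simp add: i_def)
  next
    case MInf
    then show ?thesis using assms(2) by (auto simp: proper_fun_def)
  qed auto
  then show ?thesis unfolding p_def subdiff_def by blast
qed

section \<open>Monotonicity and Lipschitz estimates for subgradients\<close>

lemma subdiff_monotone:
  assumes "proper_fun f" and u: "u \<in> subdiff f x" and v: "v \<in> subdiff f y"
  shows "0 \<le> (u - v) \<bullet> (x - y)"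
proof -
  obtain a where a: "f x = ereal a" using subdiff_finite[OF assms(1) u] .
  obtain b where b: "f y = ereal b" using subdiff_finite[OF assms(1) v] .
  have "ereal a + ereal (u \<bullet> (y - x)) \<le> ereal b" "ereal b + ereal (v \<bullet> (x - y)) \<le> ereal a"
    using u v a b unfolding subdiff_def by (metis (mono_tags, lifting) mem_Collect_eq)+
  then show ?thesis by (simp add: inner_diff_left inner_diff_right)
qed

text \<open>The subgradient inequality at a point of the segment is combined with strong convexity
  there. After division by \<open>t\<close>, the factor \<open>1 - t\<close> leaves an error
  \<open>t * n\<close>, which vanishes in the limit.\<close>

lemma subdiff_strongly_convex:
  assumes "strongly_convex_fun \<mu> f" and "u \<in> subdiff f y"
    and "f x = ereal a" and "f y = ereal b"
  shows "b + u \<bullet> (x - y) + \<mu> / 2 * (norm (x - y))\<^sup>2 \<le> a"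
proof -
  define n where "n = \<mu> / 2 * (norm (x - y))\<^sup>2"
  have "b + u \<bullet> (x - y) + n \<le> a + t * n" if t: "0 < t" "t < 1" for t
  proof -
    let ?y = "t *\<^sub>R x + (1 - t) *\<^sub>R y"
    have "?y - y = t *\<^sub>R (x - y)" by (simp add: algebra_simps)
    then have "ereal (b + t * (u \<bullet> (x - y))) \<le> f ?y"
      using assms(2,4) unfolding subdiff_def
      by (metis (mono_tags, lifting) inner_scaleR_right mem_Collect_eq plus_ereal.simps(1))
    then have "ereal (b + t * (u \<bullet> (x - y))) + ereal (\<mu> / 2 * t * (1 - t) * (norm (x - y))\<^sup>2)
        \<le> f ?y + ereal (\<mu> / 2 * t * (1 - t) * (norm (x - y))\<^sup>2)"
      by (rule add_right_mono)
    also have "\<dots> \<le> ereal t * f x + ereal (1 - t) * f y"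
      using assms(1) t unfolding strongly_convex_fun_def by auto
    finally have "t * (b + u \<bullet> (x - y) + n) \<le> t * (a + t * n)"
      using assms(3,4) by (simp add: n_def algebra_simps diff_divide_distrib)
    then show ?thesis using t by simp
  qed
  then show ?thesis unfolding n_def by (rule le_if_le_add_small_mult)
qed

text \<open>Adding the strong subgradient inequalities at both points cancels the function values
  and joins the two halves of \<open>\<mu>\<close>.\<close>

lemma subdiff_strongly_monotone:
  assumes "proper_fun f" and "strongly_convex_fun \<mu> f"
    and u: "u \<in> subdiff f x" and v: "v \<in> subdiff f y"
  shows "\<mu> * (norm (x - y))\<^sup>2 \<le> (u - v) \<bullet> (x - y)"
proof -
  obtain a where a: "f x = ereal a" using subdiff_finite[OF assms(1) u] .
  obtain b where b: "f y = ereal b" using subdiff_finite[OF assms(1) v] .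
  show ?thesis
    using subdiff_strongly_convex[OF assms(2) v a b] subdiff_strongly_convex[OF assms(2) u b a]
    by (simp add: inner_diff_left inner_diff_right norm_minus_commute)
qed

text \<open>Subtracting the linear function given by \<open>u\<close> turns \<open>x\<close> into a
  global minimizer, where the derivative must vanish.\<close>

lemma subdiff_eq_gradient:
  assumes "\<And>y. \<bar>f y\<bar> \<noteq> \<infinity>" and "GDERIV (\<lambda>y. real_of_ereal (f y)) x :> G"
    and u: "u \<in> subdiff f x"
  shows "u = G"
proof -
  let ?F = "\<lambda>y. real_of_ereal (f y) - u \<bullet> y"
  have "(?F has_derivative (\<lambda>h. h \<bullet> G - u \<bullet> h)) (at x)"
    using assms(2) unfolding gderiv_def by (auto intro!: derivative_eq_intros)
  moreover have "?F x \<le> ?F y" for y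
  proof -
    have "f x + ereal (u \<bullet> (y - x)) \<le> f y" using u by (simp add: subdiff_def)
    moreover obtain a b where "f x = ereal a" "f y = ereal b"
      using assms(1)[of x] assms(1)[of y] by (cases "f x"; cases "f y") auto
    ultimately show ?thesis by (simp add: inner_diff_right)
  qed
  ultimately have "(\<lambda>h. h \<bullet> G - u \<bullet> h) = (\<lambda>h. 0)"
    by (intro has_derivative_local_min) auto
  then have "h \<bullet> (G - u) = 0" for h
    by (metis inner_commute inner_diff_right)
  then show ?thesis by (metis eq_iff_diff_eq_0 inner_eq_zero_iff)
qed

lemma subdiff_lipschitz:
  assumes "differentiable_with_lipschitz_gradient L f"
    and "u \<in> subdiff f x" and "v \<in> subdiff f y"
  shows "norm (u - v) \<le> L * norm (x - y)"
proof -
  obtain G where G: "\<And>x. GDERIV (\<lambda>y. real_of_ereal (f y)) x :> G x"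
    and L: "L-lipschitz_on UNIV G" and fin: "\<And>x. \<bar>f x\<bar> \<noteq> \<infinity>"
    using assms(1) unfolding differentiable_with_lipschitz_gradient_def by blast
  have "u = G x" "v = G y"
    using subdiff_eq_gradient[OF fin G] assms(2,3) by auto
  then show ?thesis using lipschitz_onD[OF L, of x y] by (simp add: dist_norm)
qed

section \<open>Distance estimates for reflections\<close>

lemma norm_sq_reflect:
  fixes d e :: "'a::real_inner"
  shows "(norm (d - e))\<^sup>2 = (norm (d + e))\<^sup>2 - 4 * (d \<bullet> e)"
  unfolding power2_norm_eq_inner
  by (simp add: inner_add_left inner_add_right inner_diff_left inner_diff_right inner_commute)

lemma refl_prox_nonexpansive:
  fixes f :: "'a::{real_inner, complete_space} \<Rightarrow> ereal"
  assumes "closed_fun f" and "proper_fun f" and "convex_fun f" and "\<gamma> > 0"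
    and "u \<in> subdiff f a"
  shows "(norm (refl_prox \<gamma> f x - refl_prox \<gamma> f y))\<^sup>2 \<le> (norm (x - y))\<^sup>2"
proof -
  define d where "d = prox \<gamma> f x - prox \<gamma> f y"
  define e where "e = (x - prox \<gamma> f x) - (y - prox \<gamma> f y)"
  note sub = prox_subdiff[OF assms]
  have "0 \<le> ((1 / \<gamma>) *\<^sub>R e) \<bullet> d"
    using subdiff_monotone[OF assms(2) sub sub, of x y] by (simp add: d_def e_def scaleR_diff_right)
  then have "0 \<le> d \<bullet> e" using assms(4) by (simp add: inner_commute zero_le_divide_iff)
  moreover have "refl_prox \<gamma> f x - refl_prox \<gamma> f y = d - e" "x - y = d + e"
    by (simp_all add: refl_prox_def d_def e_def scaleR_2)
  ultimately show ?thesis by (simp add: norm_sq_reflect)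
qed

lemma refl_prox_contraction:
  fixes f :: "'a::{real_inner, complete_space} \<Rightarrow> ereal"
  assumes "closed_fun f" and "proper_fun f" and "convex_fun f" and "\<gamma> > 0"
    and "u \<in> subdiff f a" and "\<mu> \<ge> 0" and "\<beta> > 0"
    and "strongly_convex_fun \<mu> f" and "differentiable_with_lipschitz_gradient (1 / \<beta>) f"
  shows "(norm (refl_prox \<gamma> f x - refl_prox \<gamma> f y))\<^sup>2
    \<le> (1 - 4 * \<gamma> * \<mu> / (1 + \<gamma> / \<beta>)\<^sup>2) * (norm (x - y))\<^sup>2"
proof -
  define d where "d = prox \<gamma> f x - prox \<gamma> f y"
  define e where "e = (x - prox \<gamma> f x) - (y - prox \<gamma> f y)"
  define K where "K = 1 + \<gamma> / \<beta>"
  have K: "K > 0" using assms(4,7) by (simp add: K_def add_pos_pos)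
  note sub = prox_subdiff[OF assms(1-5)]
  have diff: "(1 / \<gamma>) *\<^sub>R (x - prox \<gamma> f x) - (1 / \<gamma>) *\<^sub>R (y - prox \<gamma> f y) = (1 / \<gamma>) *\<^sub>R e"
    by (simp add: e_def scaleR_diff_right)
  have "\<mu> * (norm d)\<^sup>2 \<le> ((1 / \<gamma>) *\<^sub>R e) \<bullet> d"
    using subdiff_strongly_monotone[OF assms(2,8) sub sub, of x y] by (simp only: diff d_def)
  then have mono: "\<gamma> * \<mu> * (norm d)\<^sup>2 \<le> d \<bullet> e"
    using assms(4) by (simp add: inner_commute field_simps)
  have "norm ((1 / \<gamma>) *\<^sub>R e) \<le> 1 / \<beta> * norm d"
    using subdiff_lipschitz[OF assms(9) sub sub, of x y] by (simp only: diff d_def)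
  then have "norm e \<le> \<gamma> / \<beta> * norm d"
    using assms(4) by (simp add: field_simps)
  then have "norm (d + e) \<le> K * norm d"
    using norm_triangle_ineq[of d e] by (simp add: K_def algebra_simps)
  then have "(norm (d + e))\<^sup>2 \<le> K\<^sup>2 * (norm d)\<^sup>2"
    by (metis norm_ge_zero power_mono power_mult_distrib)
  \<comment> \<open>A lower bound for \<open>norm d\<close> is needed: it turns the gain from strong
    monotonicity, measured in \<open>d\<close>, into one measured in
    \<open>d + e = x - y\<close>.\<close>
  then have "(norm (d + e))\<^sup>2 / K\<^sup>2 \<le> (norm d)\<^sup>2"
    using K by (simp add: field_simps)
  then have "\<gamma> * \<mu> * ((norm (d + e))\<^sup>2 / K\<^sup>2) \<le> \<gamma> * \<mu> * (norm d)\<^sup>2"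
    using assms(4,6) by (intro mult_left_mono) auto
  then have "(norm (d - e))\<^sup>2 \<le> (1 - 4 * \<gamma> * \<mu> / K\<^sup>2) * (norm (d + e))\<^sup>2"
    using mono unfolding norm_sq_reflect by (simp add: left_diff_distrib mult.assoc)
  moreover have "refl_prox \<gamma> f x - refl_prox \<gamma> f y = d - e" "x - y = d + e"
    by (simp_all add: refl_prox_def d_def e_def scaleR_2)
  ultimately show ?thesis by (simp add: K_def)
qed

section \<open>The relaxed step\<close>

lemma norm_sq_convex:
  fixes a b :: "'a::real_normed_vector"
  assumes "0 \<le> t" and "t \<le> 1"
  shows "(norm ((1 - t) *\<^sub>R a + t *\<^sub>R b))\<^sup>2 \<le> (1 - t) * (norm a)\<^sup>2 + t * (norm b)\<^sup>2"
proof -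
  have "norm ((1 - t) *\<^sub>R a + t *\<^sub>R b) \<le> (1 - t) * norm a + t * norm b"
    using assms norm_triangle_ineq[of "(1 - t) *\<^sub>R a" "t *\<^sub>R b"] by simp
  then have "(norm ((1 - t) *\<^sub>R a + t *\<^sub>R b))\<^sup>2 \<le> ((1 - t) * norm a + t * norm b)\<^sup>2"
    by (intro power_mono) auto
  \<comment> \<open>The subtracted term is the exact convexity defect of the real square.\<close>
  also have "\<dots> = (1 - t) * (norm a)\<^sup>2 + t * (norm b)\<^sup>2 - t * (1 - t) * (norm a - norm b)\<^sup>2"
    by (simp add: power2_eq_square algebra_simps)
  also have "\<dots> \<le> (1 - t) * (norm a)\<^sup>2 + t * (norm b)\<^sup>2"
    using assms by simp
  finally show ?thesis .
qed

theorem theorem6: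
  fixes f g :: "'a::{real_inner, complete_space} \<Rightarrow> ereal"
    and \<gamma> \<mu>f \<beta>f :: real
    and lam :: "nat \<Rightarrow> real"
    and z :: "nat \<Rightarrow> 'a"
    and zstar xstar :: 'a
  assumes "closed_fun f" and "proper_fun f" and "convex_fun f"
    and "closed_fun g" and "proper_fun g" and "convex_fun g"
    and "\<exists>x. 0 \<in> subdiff f x + subdiff g x"
    and "\<gamma> > 0"
    and "\<And>j. 0 < lam j \<and> lam j \<le> 1"
    and "relaxed_PRS \<gamma> f g lam z"
    and "T_PRS \<gamma> f g zstar = zstar"
    and "xstar = prox \<gamma> g zstar"
    and "\<mu>f \<ge> 0" and "\<beta>f \<ge> 0" and "\<mu>f * \<beta>f > 0"
    and "strongly_convex_fun \<mu>f f"
    and "differentiable_with_lipschitz_gradient (1 / \<beta>f) f"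
  shows "\<forall>k. norm (z (Suc k) - zstar) \<le> PRS_factor \<gamma> \<mu>f \<beta>f (lam k) * norm (z k - zstar)"
proof
  fix k
  have \<beta>: "\<beta>f > 0" using \<open>\<mu>f * \<beta>f > 0\<close> \<open>\<beta>f \<ge> 0\<close> by (auto simp: zero_less_mult_iff)
  \<comment> \<open>The zero of the sum gives each function a subgradient somewhere, as the
    existence of proximal points requires.\<close>
  obtain x u v where u: "u \<in> subdiff f x" and v: "v \<in> subdiff g x"
    using \<open>\<exists>x. 0 \<in> subdiff f x + subdiff g x\<close> unfolding set_plus_def by blast
  define c where "c = 4 * \<gamma> * \<mu>f / (1 + \<gamma> / \<beta>f)\<^sup>2"
  have c: "c \<ge> 0" unfolding c_def using \<open>\<gamma> > 0\<close> \<open>\<mu>f \<ge> 0\<close> by simp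
  define l where "l = lam k"
  have l: "0 \<le> l" "l \<le> 1" using assms(9)[of k] by (simp_all add: l_def)
  define a where "a = z k - zstar"
  define b where "b = T_PRS \<gamma> f g (z k) - T_PRS \<gamma> f g zstar"
  have contr: "(norm b)\<^sup>2 \<le> (1 - c) * (norm (refl_prox \<gamma> g (z k) - refl_prox \<gamma> g zstar))\<^sup>2"
    unfolding b_def T_PRS_def o_def c_def
    by (rule refl_prox_contraction[OF assms(1-3) \<open>\<gamma> > 0\<close> u \<open>\<mu>f \<ge> 0\<close> \<beta> assms(16,17)])
  have nonexp: "(norm (refl_prox \<gamma> g (z k) - refl_prox \<gamma> g zstar))\<^sup>2 \<le> (norm a)\<^sup>2"
    unfolding a_def by (rule refl_prox_nonexpansive[OF assms(4-6) \<open>\<gamma> > 0\<close> v])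
  show "norm (z (Suc k) - zstar) \<le> PRS_factor \<gamma> \<mu>f \<beta>f (lam k) * norm (z k - zstar)"
    unfolding PRS_factor_def c_def[symmetric] a_def[symmetric] l_def[symmetric]
  proof (rule power2_le_imp_le)
    have step: "z (Suc k) - zstar = (1 - l) *\<^sub>R a + l *\<^sub>R b"
      using assms(10,11) unfolding relaxed_PRS_def a_def b_def l_def
      by (simp add: algebra_simps)
    \<comment> \<open>This makes the radicand nonnegative, so that squaring undoes
      \<open>sqrt\<close> and the right-hand side is nonnegative.\<close>
    have half: "l * (min c (1 - l) / 2) \<le> 1 * 1"
      using l c by (intro mult_mono) auto
    define w where "w = (norm (refl_prox \<gamma> g (z k) - refl_prox \<gamma> g zstar))\<^sup>2"
    \<comment> \<open>In the zero space \<open>c > 1\<close> is possible, hence the truncation at \<open>1\<close>.\<close>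
    have "(norm b)\<^sup>2 \<le> (1 - c) * w" using contr by (simp add: w_def)
    also have "\<dots> \<le> (1 - min c 1) * w"
      by (intro mult_right_mono) (auto simp: w_def)
    \<comment> \<open>Multiplying \<open>nonexp\<close> needs a nonnegative factor, which
      \<open>1 - min c 1\<close> is.\<close>
    also have "\<dots> \<le> (1 - min c 1) * (norm a)\<^sup>2"
      using nonexp by (intro mult_left_mono) (auto simp: w_def)
    finally have "l * (norm b)\<^sup>2 \<le> l * ((1 - min c 1) * (norm a)\<^sup>2)"
      using l by (intro mult_left_mono)
    then have "(norm (z (Suc k) - zstar))\<^sup>2 \<le> (1 - l * min c 1) * (norm a)\<^sup>2"
      using norm_sq_convex[OF l, of a b] unfolding step by (simp add: algebra_simps)
    \<comment> \<open>Since \<open>min c (1 - l)\<close> is nonnegative and at most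
      \<open>min c 1\<close>, half of it is a weaker rate.\<close>
    also have "\<dots> \<le> (1 - l / 2 * min c (1 - l)) * (norm a)\<^sup>2"
    proof -
      have "l * (min c (1 - l) / 2) \<le> l * min c 1"
        using l c by (intro mult_left_mono) auto
      then show ?thesis by (intro mult_right_mono) auto
    qed
    also have "\<dots> = (sqrt (1 - l / 2 * min c (1 - l)) * norm a)\<^sup>2"
      using half by (simp add: power_mult_distrib)
    finally show "(norm (z (Suc k) - zstar))\<^sup>2 \<le> (sqrt (1 - l / 2 * min c (1 - l)) * norm a)\<^sup>2" .
    show "0 \<le> sqrt (1 - l / 2 * min c (1 - l)) * norm a" using half by simp
  qed
qed

end
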